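(* Let $E$ and $F$ be complex Banach spaces, let $U$ be an open subset of $E$, let $p\in[1,\infty)$ and let $f\in\mathcal{H}^\infty_{\mathcal{N}^p}(U,F)$ be a right $p$-nuclear holomorphic mapping. Then $f\in\mathcal{H}^\infty_{\mathcal{K}_p}(U,F)$, i.e. $f$ has relatively $p$-compact range, with $k_p^{\mathcal{H}^\infty}(f)\leq\nu^{p\mathcal{H}^\infty}(f)$.
   Context: $\mathcal{H}^\infty(U,F)$ is the Banach space of all bounded holomorphic mappings $f\colon U\to F$ with the supremum norm $\|\cdot\|_\infty$, and $\mathcal{H}^\infty(U)=\mathcal{H}^\infty(U,\mathbb{C})$. $B_X$ is the closed unit ball of $X$. Let $p^*=p/(p-1)$ for $1<p<\infty$ and $p^*=\infty$ for $p=1$. $p$-compactness. $\ell_p(F)$ is the space of absolutely $p$-summable sequences in $F$ with norm $\|(x_n)\|_p=(\sum_n\|x_n\|^p)^{1/p}$. For $1<p<\infty$ and $(x_n)\in\ell_p(F)$, $p\text{-}\mathrm{conv}(x_n)=\{\sum_{n=1}^\infty a_nx_n\colon (a_n)\in B_{\ell_{p^*}}\}$; for $p=1$ and $(x_n)\in\ell_1(F)$, $1\text{-}\mathrm{conv}(x_n)=\{\sum_{n=1}^\infty a_nx_n\colon (a_n)\in B_{c_0}\}$. A set $K\subseteq F$ is relatively $p$-compact if $K\subseteq p\text{-}\mathrm{conv}(x_n)$ for some $(x_n)\in\ell_p(F)$; then $m_p(K)$ is the infimum of $\|(x_n)\|_p$ over all such sequences. $\mathcal{H}^\infty_{\mathcal{K}_p}(U,F)$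 is the set of holomorphic mappings $f\colon U\to F$ with $f(U)$ relatively $p$-compact in $F$, and $k_p^{\mathcal{H}^\infty}(f)=m_p(f(U))$. Right $p$-nuclear mappings. For $1\le q<\infty$, $\ell_q^{\mathrm{weak}}(X)$ is the Banach space of weakly $q$-summable sequences in $X$ with norm $\|(x_n)\|_q^{\mathrm{weak}}=\sup\{(\sum_n|\varphi(x_n)|^q)^{1/q}\colon\varphi\in B_{X^*}\}$; $\ell_\infty^{\mathrm{weak}}(X)$ is the space of bounded sequences in $X$ with norm $\sup_n\|x_n\|$. A holomorphic mapping $f\colon U\to F$ is right $p$-nuclear if there are $(g_n)\in\ell_{p^*}^{\mathrm{weak}}(\mathcal{H}^\infty(U))$ and $(y_n)\in\ell_p(F)$ such that $f=\sum_{n=1}^\infty g_n\cdot y_n$ in $(\mathcal{H}^\infty(U,F),\|\cdot\|_\infty)$, where $(g\cdot y)(x)=g(x)y$. $\mathcal{H}^\infty_{\mathcal{N}^p}(U,F)$ is the set of such mappings and $\nu^{p\mathcal{H}^\infty}(f)=\inf\{\|(g_n)\|_{p^*}^{\mathrm{weak}}\|(y_n)\|_p\}$ over all such representations. *)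

theory Defs
  imports "HOL-Analysis.Analysis"
begin

section \<open>Complex Banach spaces\<close>

text \<open>The scalar multiplication by complex numbers extends the real one of the
  underlying real Banach space, and the norm is homogeneous for it.\<close>

class complex_banach = banach +
  fixes scaleC :: "complex \<Rightarrow> 'a \<Rightarrow> 'a" (infixr \<open>*\<^sub>C\<close> 75)
  assumes scaleC_add_right: "a *\<^sub>C (x + y) = a *\<^sub>C x + a *\<^sub>C y"
    and scaleC_add_left: "(a + b) *\<^sub>C x = a *\<^sub>C x + b *\<^sub>C x"
    and scaleC_scaleC: "a *\<^sub>C b *\<^sub>C x = (a * b) *\<^sub>C x"
    and scaleC_of_real: "complex_of_real r *\<^sub>C x = r *\<^sub>R x"
    and norm_scaleC: "norm (a *\<^sub>C x) = cmod a * norm x"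

instantiation complex :: complex_banach
begin

definition scaleC_complex :: "complex \<Rightarrow> complex \<Rightarrow> complex" where
  "scaleC_complex a z = a * z"

instance
  by standard (simp_all add: scaleC_complex_def algebra_simps norm_mult scaleR_conv_of_real)

end

section \<open>Holomorphic mappings\<close>

definition holomorphic_map :: "'e::complex_banach set \<Rightarrow> ('e \<Rightarrow> 'f::complex_banach) \<Rightarrow> bool" where
  "holomorphic_map U f \<longleftrightarrow>
     (\<forall>x\<in>U. \<exists>D. (f has_derivative D) (at x) \<and> (\<forall>c v. D (c *\<^sub>C v) = c *\<^sub>C D v))"

text \<open>The element 0 is inserted only to make the norm 0 when \<open>U\<close> is empty.\<close>

definition sup_norm :: "'e set \<Rightarrow> ('e \<Rightarrow> 'f::real_normed_vector) \<Rightarrow> real" where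
  "sup_norm U f = Sup (insert 0 ((\<lambda>x. norm (f x)) ` U))"

text \<open>The mappings are total functions that matter only on \<open>U\<close>. Two of them
  represent the same element of the Banach space iff they agree on \<open>U\<close>, that is,
  iff their difference has \<open>sup_norm\<close> zero.\<close>

definition Hinf :: "'e::complex_banach set \<Rightarrow> ('e \<Rightarrow> 'f::complex_banach) set" where
  "Hinf U = {f. holomorphic_map U f \<and> bounded (f ` U)}"

text \<open>The topological dual of the space of bounded holomorphic functions on \<open>U\<close>.
  Boundedness forces a functional to depend only on the restriction to \<open>U\<close>;
  its values outside \<open>Hinf U\<close> are irrelevant.\<close>

definition Hinf_dual :: "'e::complex_banach set \<Rightarrow> (('e \<Rightarrow> complex) \<Rightarrow> complex) set" where
  "Hinf_dual U = {\<phi>.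
     (\<forall>g\<in>Hinf U. \<forall>h\<in>Hinf U. \<phi> (\<lambda>x. g x + h x) = \<phi> g + \<phi> h) \<and>
     (\<forall>c. \<forall>g\<in>Hinf U. \<phi> (\<lambda>x. c * g x) = c * \<phi> g) \<and>
     (\<exists>C. \<forall>g\<in>Hinf U. cmod (\<phi> g) \<le> C * sup_norm U g)}"

definition Hinf_dual_ball :: "'e::complex_banach set \<Rightarrow> (('e \<Rightarrow> complex) \<Rightarrow> complex) set" where
  "Hinf_dual_ball U =
     {\<phi> \<in> Hinf_dual U. \<forall>g\<in>Hinf U. sup_norm U g \<le> 1 \<longrightarrow> cmod (\<phi> g) \<le> 1}"

section \<open>Sequence spaces\<close>

definition conj_exponent :: "real \<Rightarrow> ereal" where
  "conj_exponent p = (if p = 1 then \<infinity> else ereal (p / (p - 1)))"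

definition ell :: "real \<Rightarrow> (nat \<Rightarrow> 'f::real_normed_vector) set" where
  "ell p = {x. summable (\<lambda>n. norm (x n) powr p)}"

definition ell_norm :: "real \<Rightarrow> (nat \<Rightarrow> 'f::real_normed_vector) \<Rightarrow> real" where
  "ell_norm p x = (\<Sum>n. norm (x n) powr p) powr (1 / p)"

text \<open>Weakly \<open>q\<close>-summable sequences in the Banach space of bounded holomorphic
  functions on \<open>U\<close>, for \<open>1 \<le> q \<le> \<infinity>\<close>.\<close>

definition ell_weak_Hinf :: "ereal \<Rightarrow> 'e::complex_banach set \<Rightarrow> (nat \<Rightarrow> 'e \<Rightarrow> complex) set" where
  "ell_weak_Hinf q U = {g. (\<forall>n. g n \<in> Hinf U) \<and>
     (if q = \<infinity> then bdd_above (range (\<lambda>n. sup_norm U (g n)))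
      else \<forall>\<phi>\<in>Hinf_dual U. (\<lambda>n. \<phi> (g n)) \<in> ell (real_of_ereal q))}"

definition weak_norm_Hinf :: "ereal \<Rightarrow> 'e::complex_banach set \<Rightarrow> (nat \<Rightarrow> 'e \<Rightarrow> complex) \<Rightarrow> real" where
  "weak_norm_Hinf q U g =
     (if q = \<infinity> then (SUP n. sup_norm U (g n))
      else (SUP \<phi>\<in>Hinf_dual_ball U. ell_norm (real_of_ereal q) (\<lambda>n. \<phi> (g n))))"

section \<open>Relatively \<open>p\<close>-compact sets\<close>

text \<open>The coefficients of \<open>p\<close>-convex combinations: the closed unit ball of
  \<open>c\<^sub>0\<close> (not of the space of all bounded sequences) if \<open>p = 1\<close>, and that of the
  scalar sequence space with the conjugate exponent if \<open>p > 1\<close>.\<close>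

definition coeff_ball :: "real \<Rightarrow> (nat \<Rightarrow> complex) set" where
  "coeff_ball p =
     (if p = 1 then {a. a \<longlonglongrightarrow> 0 \<and> (\<forall>n. cmod (a n) \<le> 1)}
      else {a \<in> ell (real_of_ereal (conj_exponent p)).
              ell_norm (real_of_ereal (conj_exponent p)) a \<le> 1})"

definition p_conv :: "real \<Rightarrow> (nat \<Rightarrow> 'f::complex_banach) \<Rightarrow> 'f set" where
  "p_conv p x = {\<Sum>n. a n *\<^sub>C x n | a. a \<in> coeff_ball p}"

definition relatively_p_compact :: "real \<Rightarrow> 'f::complex_banach set \<Rightarrow> bool" where
  "relatively_p_compact p K \<longleftrightarrow> (\<exists>x\<in>ell p. K \<subseteq> p_conv p x)"

definition m_p :: "real \<Rightarrow> 'f::complex_banach set \<Rightarrow> real" where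
  "m_p p K = Inf {ell_norm p x | x. x \<in> ell p \<and> K \<subseteq> p_conv p x}"

definition Hinf_K :: "real \<Rightarrow> 'e::complex_banach set \<Rightarrow> ('e \<Rightarrow> 'f::complex_banach) set" where
  "Hinf_K p U = {f. holomorphic_map U f \<and> relatively_p_compact p (f ` U)}"

definition k_p :: "real \<Rightarrow> 'e::complex_banach set \<Rightarrow> ('e \<Rightarrow> 'f::complex_banach) \<Rightarrow> real" where
  "k_p p U f = m_p p (f ` U)"

section \<open>Right \<open>p\<close>-nuclear holomorphic mappings\<close>

text \<open>The series converges to \<open>f\<close> in the supremum norm on \<open>U\<close>.\<close>

definition right_nuclear_rep ::
  "real \<Rightarrow> 'e::complex_banach set \<Rightarrow> ('e \<Rightarrow> 'f::complex_banach) \<Rightarrow>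
     (nat \<Rightarrow> 'e \<Rightarrow> complex) \<Rightarrow> (nat \<Rightarrow> 'f) \<Rightarrow> bool" where
  "right_nuclear_rep p U f g y \<longleftrightarrow>
     g \<in> ell_weak_Hinf (conj_exponent p) U \<and> y \<in> ell p \<and>
     (\<lambda>N. sup_norm U (\<lambda>x. f x - (\<Sum>n<N. g n x *\<^sub>C y n))) \<longlonglongrightarrow> 0"

definition Hinf_N :: "real \<Rightarrow> 'e::complex_banach set \<Rightarrow> ('e \<Rightarrow> 'f::complex_banach) set" where
  "Hinf_N p U = {f \<in> Hinf U. \<exists>g y. right_nuclear_rep p U f g y}"

definition nu_p :: "real \<Rightarrow> 'e::complex_banach set \<Rightarrow> ('e \<Rightarrow> 'f::complex_banach) \<Rightarrow> real" where
  "nu_p p U f = Inf {weak_norm_Hinf (conj_exponent p) U g * ell_norm p y | g y.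
     right_nuclear_rep p U f g y}"

end

theory Submission
  imports Defs
begin

text \<open>Let \<open>f = (\<Sum>n. g n \<cdot> y n)\<close> be a nuclear representation, \<open>w\<close> the weak norm of \<open>g\<close>, and
  \<open>W > w\<close>.  Evaluation at a point \<open>x\<close> of \<open>U\<close> is a functional of norm at most one, so the scalars
  \<open>g n x\<close> have norm at most \<open>w\<close> in the sequence space of the conjugate exponent, uniformly in
  \<open>x\<close>.  Hence \<open>f x = (\<Sum>n. (g n x / W) \<cdot> (W y n))\<close> exhibits every value of \<open>f\<close> as a \<open>p\<close>-convex
  combination of the one sequence \<open>W y n\<close>, and the estimate for \<open>m_p\<close> follows by letting \<open>W\<close>
  decrease to \<open>w\<close>.

  Two points need an argument beyond this.  If \<open>p = 1\<close>, the scalars \<open>g n x\<close> are only bounded,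
  whereas \<open>1\<close>-convex combinations require null sequences of coefficients;
  \<open>exists_divergent_weight\<close> supplies weights \<open>b n\<close> tending to infinity that hardly increase the
  norm of \<open>y\<close>, and one writes \<open>g n x \<cdot> y n\<close> as \<open>(g n x / (W b n)) \<cdot> (W b n y n)\<close>.
  If \<open>p > 1\<close>, the weak norm is a supremum of real numbers, and it dominates the individual values
  only because the set is bounded above.  That a weakly summable sequence has finite weak norm is an
  instance of the uniform boundedness principle on the dual of the space of bounded holomorphic
  functions, proved in \<open>weak_power_sums_uniformly_bounded\<close> by nesting balls in that dual.\<close>

section \<open>Bounded holomorphic functions and their functionals\<close>

lemma bdd_above_sup_norm_set:
  assumes "bounded (f ` U)"
  shows "bdd_above (insert 0 ((\<lambda>x. norm (f x)) ` U))"
proof -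
  obtain B where "\<forall>y\<in>f ` U. norm y \<le> B" using assms bounded_iff by blast
  then show ?thesis by (intro bdd_aboveI[of _ "max 0 B"]) fastforce
qed

lemma norm_le_sup_norm:
  assumes "bounded (f ` U)" "x \<in> U"
  shows "norm (f x) \<le> sup_norm U f"
  unfolding sup_norm_def
  by (rule cSup_upper[OF _ bdd_above_sup_norm_set[OF assms(1)]]) (use assms(2) in auto)

lemma sup_norm_nonneg:
  assumes "bounded (f ` U)"
  shows "0 \<le> sup_norm U f"
  unfolding sup_norm_def
  by (rule cSup_upper[OF _ bdd_above_sup_norm_set[OF assms]]) auto

lemma Hinf_bounded: "f \<in> Hinf U \<Longrightarrow> bounded (f ` U)"
  by (simp add: Hinf_def)

lemma Hinf_mult_const:
  fixes g :: "'e::complex_banach \<Rightarrow> complex"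
  assumes "g \<in> Hinf U"
  shows "(\<lambda>x. c * g x) \<in> Hinf U"
proof -
  have hol: "holomorphic_map U g" using assms by (simp add: Hinf_def)
  have "\<exists>D'. ((\<lambda>x. c * g x) has_derivative D') (at x) \<and> (\<forall>a v. D' (a *\<^sub>C v) = a *\<^sub>C D' v)"
    if x: "x \<in> U" for x
  proof -
    obtain D where D: "(g has_derivative D) (at x)" "\<forall>a v. D (a *\<^sub>C v) = a *\<^sub>C D v"
      using hol x unfolding holomorphic_map_def by blast
    have "((\<lambda>x. c * g x) has_derivative (\<lambda>v. c * D v)) (at x)"
      by (rule has_derivative_mult_right[OF D(1)])
    moreover have "\<forall>a v. c * D (a *\<^sub>C v) = a *\<^sub>C (c * D v)"
      using D(2) by (simp add: scaleC_complex_def)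
    ultimately show ?thesis by (intro exI[of _ "\<lambda>v. c * D v"] conjI)
  qed
  moreover have "bounded ((\<lambda>x. c * g x) ` U)"
  proof -
    obtain B where B: "\<forall>x\<in>U. norm (g x) \<le> B"
      using Hinf_bounded[OF assms] by (auto simp: bounded_iff)
    show ?thesis unfolding bounded_iff
      by (rule exI[of _ "norm c * B"]) (use B in \<open>auto simp: norm_mult intro!: mult_left_mono\<close>)
  qed
  ultimately show ?thesis by (simp add: Hinf_def holomorphic_map_def)
qed

text \<open>The unit ball of the dual is defined by testing on the unit ball only; the homogeneous
  estimate follows by rescaling, except for functions of norm zero, which every functional kills
  because it is bounded.\<close>

lemma Hinf_dual_ball_norm_le:
  assumes \<phi>: "\<phi> \<in> Hinf_dual_ball U" and g: "g \<in> Hinf U"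
  shows "cmod (\<phi> g) \<le> sup_norm U g"
proof (cases "sup_norm U g = 0")
  case True
  obtain C where "\<forall>g\<in>Hinf U. cmod (\<phi> g) \<le> C * sup_norm U g"
    using \<phi> by (auto simp: Hinf_dual_ball_def Hinf_dual_def)
  with g True show ?thesis by force
next
  case False
  define s where "s = sup_norm U g"
  have s: "s > 0" using False sup_norm_nonneg[OF Hinf_bounded[OF g]] by (simp add: s_def)
  define h where "h = (\<lambda>x. complex_of_real (1/s) * g x)"
  have h: "h \<in> Hinf U" unfolding h_def by (rule Hinf_mult_const[OF g])
  have "sup_norm U h \<le> 1"
    unfolding sup_norm_def
  proof (rule cSup_least)
    fix t assume "t \<in> insert 0 ((\<lambda>x. norm (h x)) ` U)"
    moreover have "norm (h x) \<le> 1" if "x \<in> U" for x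
      using norm_le_sup_norm[OF Hinf_bounded[OF g] that] s
      by (simp add: h_def norm_mult norm_divide s_def)
    ultimately show "t \<le> 1" by auto
  qed auto
  then have "cmod (\<phi> h) \<le> 1" using \<phi> h by (auto simp: Hinf_dual_ball_def)
  moreover have "\<phi> h = complex_of_real (1/s) * \<phi> g"
    using \<phi> g unfolding Hinf_dual_ball_def Hinf_dual_def h_def by blast
  ultimately show ?thesis using s by (simp add: norm_mult norm_divide s_def)
qed

lemma evaluation_in_Hinf_dual_ball:
  assumes "x \<in> U"
  shows "(\<lambda>g. g x) \<in> Hinf_dual_ball U"
proof -
  have "cmod (g x) \<le> sup_norm U g" if "g \<in> Hinf U" for g
    by (rule norm_le_sup_norm[OF Hinf_bounded[OF that] assms])
  then show ?thesis unfolding Hinf_dual_ball_def Hinf_dual_def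
    by (auto intro!: exI[of _ 1] intro: order_trans)
qed

lemma zero_in_Hinf_dual_ball: "(\<lambda>g. 0) \<in> Hinf_dual_ball U"
  unfolding Hinf_dual_ball_def Hinf_dual_def by (auto intro!: exI[of _ 0])

lemma Hinf_dual_add_mult:
  assumes \<phi>: "\<phi> \<in> Hinf_dual U" and \<theta>: "\<theta> \<in> Hinf_dual U"
  shows "(\<lambda>g. \<phi> g + c * \<theta> g) \<in> Hinf_dual U"
proof -
  obtain A where A: "\<forall>g\<in>Hinf U. cmod (\<phi> g) \<le> A * sup_norm U g"
    using \<phi> by (auto simp: Hinf_dual_def)
  obtain B where B: "\<forall>g\<in>Hinf U. cmod (\<theta> g) \<le> B * sup_norm U g"
    using \<theta> by (auto simp: Hinf_dual_def)
  have "cmod (\<phi> g + c * \<theta> g) \<le> (A + cmod c * B) * sup_norm U g" if "g \<in> Hinf U" for g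
  proof -
    have "cmod (\<phi> g + c * \<theta> g) \<le> cmod (\<phi> g) + cmod c * cmod (\<theta> g)"
      by (metis norm_mult norm_triangle_ineq)
    also have "\<dots> \<le> A * sup_norm U g + cmod c * (B * sup_norm U g)"
      using A B that by (intro add_mono mult_left_mono) auto
    finally show ?thesis by (simp add: algebra_simps)
  qed
  then show ?thesis using \<phi> \<theta> unfolding Hinf_dual_def
    by (auto simp: algebra_simps intro!: exI[of _ "A + cmod c * B"])
qed

section \<open>Uniform boundedness for weakly summable sequences\<close>

text \<open>This replaces the triangle inequality for the \<open>q\<close>-norm in the proof of the uniform
  boundedness principle: since \<open>b\<close> is half the difference of \<open>a + b\<close> and \<open>a - b\<close>, translating
  a large perturbation by \<open>a\<close> keeps it large for at least one of the two signs.\<close>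

lemma norm_powr_le_sum_translates:
  fixes a b :: "'a::real_normed_vector"
  assumes "0 < q"
  shows "norm b powr q \<le> norm (a + b) powr q + norm (a - b) powr q"
proof -
  have "2 * norm b = norm ((a + b) - (a - b))"
    by (simp add: scaleR_2[symmetric])
  also have "\<dots> \<le> norm (a + b) + norm (a - b)" by (rule norm_triangle_ineq4)
  finally have "norm b \<le> norm (a + b) \<or> norm b \<le> norm (a - b)" by linarith
  then show ?thesis
  proof
    assume "norm b \<le> norm (a + b)"
    then have "norm b powr q \<le> norm (a + b) powr q" using assms by (intro powr_mono2) auto
    then show ?thesis by (smt (verit) powr_ge_zero)
  next
    assume "norm b \<le> norm (a - b)"
    then have "norm b powr q \<le> norm (a - b) powr q" using assms by (intro powr_mono2) auto
    then show ?thesis by (smt (verit) powr_ge_zero)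
  qed
qed

text \<open>Completeness of the dual, in the form needed for nested balls with centres \<open>\<Phi> k\<close> and radii
  \<open>r k\<close> tending to zero: the centres converge pointwise, and the estimates, linearity and
  boundedness pass to the limit.\<close>

lemma Hinf_dual_nested_balls:
  assumes \<Phi>: "\<And>k. \<Phi> k \<in> Hinf_dual U"
    and near: "\<And>k m g. k \<le> m \<Longrightarrow> g \<in> Hinf U \<Longrightarrow> cmod (\<Phi> k g - \<Phi> m g) \<le> r k * sup_norm U g"
    and r: "r \<longlonglongrightarrow> 0"
  obtains \<eta> where "\<eta> \<in> Hinf_dual U"
    and "\<And>k g. g \<in> Hinf U \<Longrightarrow> cmod (\<Phi> k g - \<eta> g) \<le> r k * sup_norm U g"
proof -
  have conv: "convergent (\<lambda>k. \<Phi> k g)" if g: "g \<in> Hinf U" for g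
  proof -
    have lim0: "(\<lambda>k. r k * sup_norm U g) \<longlonglongrightarrow> 0" using tendsto_mult_left_zero[OF r] .
    have "Cauchy (\<lambda>k. \<Phi> k g)"
    proof (rule metric_CauchyI)
      fix e :: real assume "0 < e"
      then have "\<forall>\<^sub>F k in sequentially. r k * sup_norm U g < e/2"
        by (intro order_tendstoD(2)[OF lim0]) auto
      then obtain K where K: "r K * sup_norm U g < e/2" by (auto simp: eventually_sequentially)
      have "dist (\<Phi> m g) (\<Phi> n g) < e" if "K \<le> m" "K \<le> n" for m n
      proof (rule dist_triangle_half_r)
        show "dist (\<Phi> K g) (\<Phi> m g) < e/2" "dist (\<Phi> K g) (\<Phi> n g) < e/2"
          using near[OF that(1) g] near[OF that(2) g] K by (simp_all add: dist_norm)
      qed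
      then show "\<exists>M. \<forall>m\<ge>M. \<forall>n\<ge>M. dist (\<Phi> m g) (\<Phi> n g) < e" by blast
    qed
    then show ?thesis by (rule Cauchy_convergent)
  qed
  define \<eta> where "\<eta> = (\<lambda>g. lim (\<lambda>k. \<Phi> k g))"
  have lim: "(\<lambda>k. \<Phi> k g) \<longlonglongrightarrow> \<eta> g" if "g \<in> Hinf U" for g
    unfolding \<eta>_def using conv[OF that] by (simp add: convergent_LIMSEQ_iff)
  have close: "cmod (\<Phi> k g - \<eta> g) \<le> r k * sup_norm U g" if g: "g \<in> Hinf U" for k g
  proof (rule LIMSEQ_le_const2)
    show "(\<lambda>m. cmod (\<Phi> k g - \<Phi> m g)) \<longlonglongrightarrow> cmod (\<Phi> k g - \<eta> g)"
      by (intro tendsto_intros lim g)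
    show "\<exists>N. \<forall>m\<ge>N. cmod (\<Phi> k g - \<Phi> m g) \<le> r k * sup_norm U g"
      using near[OF _ g] by blast
  qed
  obtain C where C: "\<forall>g\<in>Hinf U. cmod (\<Phi> 0 g) \<le> C * sup_norm U g"
    using \<Phi>[of 0] by (auto simp: Hinf_dual_def)
  have bound: "cmod (\<eta> g) \<le> (C + r 0) * sup_norm U g" if g: "g \<in> Hinf U" for g
  proof -
    have "cmod (\<eta> g) \<le> cmod (\<Phi> 0 g) + cmod (\<Phi> 0 g - \<eta> g)"
      by (metis norm_minus_commute norm_triangle_sub)
    also have "\<dots> \<le> (C + r 0) * sup_norm U g"
      using C g close[OF g, of 0] by (simp add: distrib_right add_mono)
    finally show ?thesis .
  qed
  have add: "\<eta> (\<lambda>x. g x + h x) = \<eta> g + \<eta> h" if g: "g \<in> Hinf U" and h: "h \<in> Hinf U" for g h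
  proof -
    have "(\<lambda>k. \<Phi> k (\<lambda>x. g x + h x)) = (\<lambda>k. \<Phi> k g + \<Phi> k h)"
      using \<Phi> g h by (simp add: Hinf_dual_def)
    moreover have "(\<lambda>k. \<Phi> k g + \<Phi> k h) \<longlonglongrightarrow> \<eta> g + \<eta> h"
      by (intro tendsto_add lim g h)
    ultimately show ?thesis unfolding \<eta>_def using limI by metis
  qed
  have mult: "\<eta> (\<lambda>x. c * g x) = c * \<eta> g" if g: "g \<in> Hinf U" for c g
  proof -
    have "(\<lambda>k. \<Phi> k (\<lambda>x. c * g x)) = (\<lambda>k. c * \<Phi> k g)"
      using \<Phi> g by (simp add: Hinf_dual_def)
    moreover have "(\<lambda>k. c * \<Phi> k g) \<longlonglongrightarrow> c * \<eta> g" by (intro tendsto_mult_left lim g)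
    ultimately show ?thesis unfolding \<eta>_def using limI by metis
  qed
  have "\<eta> \<in> Hinf_dual U"
    unfolding Hinf_dual_def using add mult bound by blast
  with close show ?thesis using that by blast
qed

text \<open>A partial power sum involves finitely many values of the functional and so depends
  continuously on it: exceeding \<open>c\<close> is an open condition.\<close>

lemma power_sum_large_on_ball:
  fixes g :: "nat \<Rightarrow> 'e::complex_banach \<Rightarrow> complex"
  assumes q: "0 < q" and g: "\<And>n. g n \<in> Hinf U" and \<rho>: "0 < \<rho>"
    and large: "c < (\<Sum>n<N. cmod (\<psi> (g n)) powr q)"
  shows "\<exists>s>0. s \<le> \<rho> \<and>
    (\<forall>\<eta>. (\<forall>h\<in>Hinf U. cmod (\<psi> h - \<eta> h) \<le> s * sup_norm U h) \<longrightarrow>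
      c < (\<Sum>n<N. cmod (\<eta> (g n)) powr q))"
proof -
  define s where "s j = \<rho> * inverse (real (Suc j))" for j
  have s: "0 < s j" "s j \<le> \<rho>" for j using \<rho> by (auto simp: s_def field_simps)
  have s0: "s \<longlonglongrightarrow> 0"
    using tendsto_mult_right_zero[OF LIMSEQ_inverse_real_of_nat] by (simp add: s_def[abs_def])
  have "\<exists>j. \<forall>\<eta>. (\<forall>h\<in>Hinf U. cmod (\<psi> h - \<eta> h) \<le> s j * sup_norm U h) \<longrightarrow>
      c < (\<Sum>n<N. cmod (\<eta> (g n)) powr q)"
  proof (rule ccontr)
    assume "\<not> ?thesis"
    then have "\<forall>j. \<exists>\<eta>. (\<forall>h\<in>Hinf U. cmod (\<psi> h - \<eta> h) \<le> s j * sup_norm U h) \<and>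
        (\<Sum>n<N. cmod (\<eta> (g n)) powr q) \<le> c" by (meson not_less)
    then obtain H where H: "\<And>j h. h \<in> Hinf U \<Longrightarrow> cmod (\<psi> h - H j h) \<le> s j * sup_norm U h"
      and small: "\<And>j. (\<Sum>n<N. cmod (H j (g n)) powr q) \<le> c" by metis
    have "(\<lambda>j. H j (g n)) \<longlonglongrightarrow> \<psi> (g n)" for n
    proof -
      have "(\<lambda>j. s j * sup_norm U (g n)) \<longlonglongrightarrow> 0" by (rule tendsto_mult_left_zero[OF s0])
      then have "(\<lambda>j. H j (g n) - \<psi> (g n)) \<longlonglongrightarrow> 0"
        by (rule Lim_null_comparison[rotated])
          (use H[OF g] in \<open>auto simp: norm_minus_commute\<close>)
      then show ?thesis by (simp add: LIM_zero_iff)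
    qed
    then have "(\<lambda>j. \<Sum>n<N. cmod (H j (g n)) powr q) \<longlonglongrightarrow> (\<Sum>n<N. cmod (\<psi> (g n)) powr q)"
      using q by (intro tendsto_sum tendsto_powr' tendsto_norm) auto
    then have "(\<Sum>n<N. cmod (\<psi> (g n)) powr q) \<le> c"
      by (rule LIMSEQ_le_const2) (use small in auto)
    with large show False by simp
  qed
  then show ?thesis using s by blast
qed

text \<open>If the power sums were unbounded on the dual ball, every ball of the dual would contain a
  smaller one on which some partial power sum exceeds any prescribed constant: perturb the centre
  by plus or minus a scaled functional with a huge power sum.  A functional common to a nested
  sequence of such balls would have a divergent power sum.\<close>

lemma weak_power_sums_uniformly_bounded:
  fixes g :: "nat \<Rightarrow> 'e::complex_banach \<Rightarrow> complex"
  assumes q: "0 < q" and g: "\<And>n. g n \<in> Hinf U"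
    and weak: "\<And>\<phi>. \<phi> \<in> Hinf_dual U \<Longrightarrow> (\<lambda>n. \<phi> (g n)) \<in> ell q"
  shows "\<exists>C. \<forall>\<phi>\<in>Hinf_dual_ball U. (\<Sum>n. cmod (\<phi> (g n)) powr q) \<le> C"
proof -
  define S where "S N \<phi> = (\<Sum>n<N. cmod (\<phi> (g n)) powr q)" for N \<phi>
  have "\<exists>C. \<forall>\<phi>\<in>Hinf_dual_ball U. \<forall>N. S N \<phi> \<le> C"
  proof (rule ccontr)
    assume "\<not> ?thesis"
    then have unbounded: "\<exists>\<theta>\<in>Hinf_dual_ball U. \<exists>N. c < S N \<theta>" for c by (meson not_less)
    have step: "\<exists>\<psi> s. (\<psi> \<in> Hinf_dual U \<and> 0 < s) \<and> s \<le> r/2 \<and>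
        (\<forall>h\<in>Hinf U. cmod (\<phi> h - \<psi> h) \<le> r/2 * sup_norm U h) \<and>
        (\<exists>N. \<forall>\<eta>. (\<forall>h\<in>Hinf U. cmod (\<psi> h - \<eta> h) \<le> s * sup_norm U h) \<longrightarrow> c < S N \<eta>)"
      if \<phi>: "\<phi> \<in> Hinf_dual U" and r: "0 < r" for \<phi> r c
    proof -
      obtain \<theta> N where \<theta>: "\<theta> \<in> Hinf_dual_ball U" and big: "2 * c / (r/2) powr q < S N \<theta>"
        using unbounded by blast
      define \<psi> where "\<psi> a = (\<lambda>h. \<phi> h + complex_of_real a * \<theta> h)" for a
      have "2 * c < (r/2) powr q * S N \<theta>"
        using big r by (simp add: field_simps)
      also have "\<dots> = (\<Sum>n<N. cmod (complex_of_real (r/2) * \<theta> (g n)) powr q)"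
        unfolding S_def sum_distrib_left
      proof (rule sum.cong[OF refl])
        fix n
        have "cmod (complex_of_real (r/2) * \<theta> (g n)) = r/2 * cmod (\<theta> (g n))"
          using r by (simp add: norm_mult)
        moreover have "(r/2 * cmod (\<theta> (g n))) powr q = (r/2) powr q * cmod (\<theta> (g n)) powr q"
          by (rule powr_mult)
        ultimately show "(r/2) powr q * cmod (\<theta> (g n)) powr q
            = cmod (complex_of_real (r/2) * \<theta> (g n)) powr q" by metis
      qed
      also have "\<dots> \<le> (\<Sum>n<N. cmod (\<psi> (r/2) (g n)) powr q + cmod (\<psi> (-(r/2)) (g n)) powr q)"
      proof (rule sum_mono)
        fix n
        show "cmod (complex_of_real (r/2) * \<theta> (g n)) powr q
            \<le> cmod (\<psi> (r/2) (g n)) powr q + cmod (\<psi> (-(r/2)) (g n)) powr q"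
          using norm_powr_le_sum_translates[OF q, of "complex_of_real (r/2) * \<theta> (g n)" "\<phi> (g n)"]
          by (simp only: \<psi>_def of_real_minus mult_minus_left add_uminus_conv_diff)
      qed
      also have "\<dots> = S N (\<psi> (r/2)) + S N (\<psi> (-(r/2)))" by (simp add: S_def sum.distrib)
      finally have "c < S N (\<psi> (r/2)) \<or> c < S N (\<psi> (-(r/2)))" by linarith
      moreover have "\<bar>r/2\<bar> = r/2" "\<bar>-(r/2)\<bar> = r/2" using r by simp_all
      ultimately have "\<exists>a. \<bar>a\<bar> = r/2 \<and> c < S N (\<psi> a)" by blast
      then obtain a where a: "\<bar>a\<bar> = r/2" "c < S N (\<psi> a)" by blast
      obtain s where s: "0 < s" "s \<le> r/2" and
        sball: "\<forall>\<eta>. (\<forall>h\<in>Hinf U. cmod (\<psi> a h - \<eta> h) \<le> s * sup_norm U h) \<longrightarrow> c < S N \<eta>"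
        using power_sum_large_on_ball[OF q g half_gt_zero[OF r] a(2)[unfolded S_def], folded S_def]
        by (elim exE conjE)
      have "\<psi> a \<in> Hinf_dual U"
        unfolding \<psi>_def using \<phi> \<theta> by (intro Hinf_dual_add_mult) (auto simp: Hinf_dual_ball_def)
      moreover have "cmod (\<phi> h - \<psi> a h) \<le> r/2 * sup_norm U h" if "h \<in> Hinf U" for h
      proof -
        have "cmod (\<phi> h - \<psi> a h) = r/2 * cmod (\<theta> h)"
          by (simp add: \<psi>_def norm_mult a)
        also have "\<dots> \<le> r/2 * sup_norm U h"
          using Hinf_dual_ball_norm_le[OF \<theta> that] r by (intro mult_left_mono) auto
        finally show ?thesis .
      qed
      moreover have "\<exists>N. \<forall>\<eta>. (\<forall>h\<in>Hinf U. cmod (\<psi> a h - \<eta> h) \<le> s * sup_norm U h) \<longrightarrow> c < S N \<eta>"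
        by (rule exI[of _ N]) (rule sball)
      ultimately show ?thesis using s by (intro exI[of _ "\<psi> a"] exI[of _ s]) simp
    qed
    \<comment> \<open>The pairs \<open>w k\<close> are centre and radius.  The next centre is at distance at most half the
      radius and the radius is at least halved, so that the balls are nested.\<close>
    have "\<exists>w. \<forall>k::nat. (fst (w k) \<in> Hinf_dual U \<and> 0 < (snd (w k) :: real)) \<and>
        (snd (w (Suc k)) \<le> snd (w k) / 2 \<and>
         (\<forall>h\<in>Hinf U. cmod (fst (w k) h - fst (w (Suc k)) h) \<le> snd (w k) / 2 * sup_norm U h) \<and>
         (\<exists>N. \<forall>\<eta>. (\<forall>h\<in>Hinf U. cmod (fst (w (Suc k)) h - \<eta> h) \<le> snd (w (Suc k)) * sup_norm U h)
            \<longrightarrow> real k < S N \<eta>))"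
    proof (rule dependent_nat_choice)
      show "\<exists>w. fst w \<in> Hinf_dual U \<and> 0 < (snd w :: real)"
        using zero_in_Hinf_dual_ball
        by (intro exI[of _ "(\<lambda>g. 0, 1)"]) (auto simp: Hinf_dual_ball_def)
    next
      fix w :: "(('e \<Rightarrow> complex) \<Rightarrow> complex) \<times> real" and k :: nat
      assume "fst w \<in> Hinf_dual U \<and> 0 < snd w"
      then show "\<exists>w'. (fst w' \<in> Hinf_dual U \<and> 0 < snd w') \<and>
          (snd w' \<le> snd w / 2 \<and>
           (\<forall>h\<in>Hinf U. cmod (fst w h - fst w' h) \<le> snd w / 2 * sup_norm U h) \<and>
           (\<exists>N. \<forall>\<eta>. (\<forall>h\<in>Hinf U. cmod (fst w' h - \<eta> h) \<le> snd w' * sup_norm U h)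
              \<longrightarrow> real k < S N \<eta>))"
        using step[of "fst w" "snd w" "real k"] by (simp add: split_paired_Ex)
    qed
    then obtain w where w: "\<And>k::nat. (fst (w k) \<in> Hinf_dual U \<and> 0 < (snd (w k) :: real)) \<and>
        (snd (w (Suc k)) \<le> snd (w k) / 2 \<and>
         (\<forall>h\<in>Hinf U. cmod (fst (w k) h - fst (w (Suc k)) h) \<le> snd (w k) / 2 * sup_norm U h) \<and>
         (\<exists>N. \<forall>\<eta>. (\<forall>h\<in>Hinf U. cmod (fst (w (Suc k)) h - \<eta> h) \<le> snd (w (Suc k)) * sup_norm U h)
            \<longrightarrow> real k < S N \<eta>))" by blast
    define \<Phi> where "\<Phi> k = fst (w k)" for k
    define r where "r k = snd (w k)" for k
    note w' = w[folded \<Phi>_def r_def]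
    have \<Phi>: "\<Phi> k \<in> Hinf_dual U" and r: "0 < r k" and halve: "r (Suc k) \<le> r k / 2" for k
      using w'[of k] by auto
    have next_near: "cmod (\<Phi> k h - \<Phi> (Suc k) h) \<le> r k / 2 * sup_norm U h" if "h \<in> Hinf U" for k h
      using w'[of k] that by blast
    have large: "\<exists>N. \<forall>\<eta>. (\<forall>h\<in>Hinf U. cmod (\<Phi> (Suc k) h - \<eta> h) \<le> r (Suc k) * sup_norm U h)
            \<longrightarrow> real k < S N \<eta>" for k
      using w'[of k] by blast
    have near: "cmod (\<Phi> k h - \<Phi> m h) \<le> r k * sup_norm U h" if "k \<le> m" and h: "h \<in> Hinf U" for k m h
    proof -
      have nn: "0 \<le> sup_norm U h" by (rule sup_norm_nonneg[OF Hinf_bounded[OF h]])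
      \<comment> \<open>Subtracting \<open>r m\<close> strengthens the claim enough for the induction to telescope.\<close>
      have "cmod (\<Phi> k h - \<Phi> m h) \<le> (r k - r m) * sup_norm U h"
        using \<open>k \<le> m\<close>
      proof (induction m rule: dec_induct)
        case base
        then show ?case by simp
      next
        case (step m)
        have "cmod (\<Phi> k h - \<Phi> (Suc m) h) \<le> cmod (\<Phi> k h - \<Phi> m h) + cmod (\<Phi> m h - \<Phi> (Suc m) h)"
          by (rule norm_diff_triangle_le[OF order_refl order_refl])
        also have "\<dots> \<le> (r k - r m) * sup_norm U h + r m / 2 * sup_norm U h"
          by (intro add_mono step next_near h)
        also have "\<dots> = (r k - r m / 2) * sup_norm U h" by (simp add: algebra_simps)
        also have "\<dots> \<le> (r k - r (Suc m)) * sup_norm U h"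
          using halve[of m] nn by (intro mult_right_mono) auto
        finally show ?case .
      qed
      also have "\<dots> \<le> r k * sup_norm U h"
        using r[of m] nn by (intro mult_right_mono) auto
      finally show ?thesis .
    qed
    have geometric: "r k \<le> r 0 * (1/2)^k" for k
    proof (induction k)
      case (Suc k)
      then show ?case using halve[of k] by simp
    qed simp
    have "r \<longlonglongrightarrow> 0"
    proof (rule tendsto_sandwich[of "\<lambda>_. 0" r _ "\<lambda>k. r 0 * (1/2)^k"])
      show "(\<lambda>k. r 0 * (1/2)^k) \<longlonglongrightarrow> 0"
        by (intro tendsto_mult_right_zero LIMSEQ_realpow_zero) auto
    qed (use r geometric in \<open>auto simp: less_imp_le\<close>)
    from Hinf_dual_nested_balls[OF \<Phi> near this]
    obtain \<eta> where \<eta>: "\<eta> \<in> Hinf_dual U"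
      and \<eta>_near: "\<And>k h. h \<in> Hinf U \<Longrightarrow> cmod (\<Phi> k h - \<eta> h) \<le> r k * sup_norm U h" by blast
    have summ: "summable (\<lambda>n. cmod (\<eta> (g n)) powr q)" using weak[OF \<eta>] by (simp add: ell_def)
    have "real k \<le> (\<Sum>n. cmod (\<eta> (g n)) powr q)" for k
    proof -
      obtain N where "real k < S N \<eta>" using large[of k] \<eta>_near by blast
      moreover have "S N \<eta> \<le> (\<Sum>n. cmod (\<eta> (g n)) powr q)"
        unfolding S_def by (rule sum_le_suminf[OF summ]) auto
      ultimately show ?thesis by simp
    qed
    then show False by (meson reals_Archimedean2 not_le)
  qed
  then obtain C where C: "\<And>\<phi> N. \<phi> \<in> Hinf_dual_ball U \<Longrightarrow> S N \<phi> \<le> C" by blast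
  have "(\<Sum>n. cmod (\<phi> (g n)) powr q) \<le> C" if "\<phi> \<in> Hinf_dual_ball U" for \<phi>
  proof (rule suminf_le_const)
    show "summable (\<lambda>n. cmod (\<phi> (g n)) powr q)"
      using weak that by (auto simp: Hinf_dual_ball_def ell_def)
    show "(\<Sum>n<N. cmod (\<phi> (g n)) powr q) \<le> C" for N
      using C[OF that, of N] by (simp add: S_def)
  qed
  then show ?thesis by blast
qed

lemma bdd_above_weak_norm:
  fixes g :: "nat \<Rightarrow> 'e::complex_banach \<Rightarrow> complex"
  assumes q: "0 < q" and g: "g \<in> ell_weak_Hinf (ereal q) U"
  shows "bdd_above ((\<lambda>\<phi>. ell_norm q (\<lambda>n. \<phi> (g n))) ` Hinf_dual_ball U)"
proof -
  obtain C where C: "\<forall>\<phi>\<in>Hinf_dual_ball U. (\<Sum>n. cmod (\<phi> (g n)) powr q) \<le> C"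
    using weak_power_sums_uniformly_bounded[OF q, of g U] g by (auto simp: ell_weak_Hinf_def)
  have "ell_norm q (\<lambda>n. \<phi> (g n)) \<le> C powr (1/q)" if "\<phi> \<in> Hinf_dual_ball U" for \<phi>
  proof -
    have "summable (\<lambda>n. cmod (\<phi> (g n)) powr q)"
      using that g by (auto simp: ell_weak_Hinf_def Hinf_dual_ball_def ell_def)
    then show ?thesis unfolding ell_norm_def
      using C that q by (intro powr_mono2) (auto intro: suminf_nonneg)
  qed
  then show ?thesis by (auto intro!: bdd_aboveI2)
qed

section \<open>Scaling and weighting summable sequences\<close>

lemma ell_scale:
  assumes p: "0 < p" and x: "x \<in> ell p" and c: "0 \<le> c" and y: "\<And>n. norm (y n) = c * norm (x n)"
  shows "y \<in> ell p" "ell_norm p y = c * ell_norm p x"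
proof -
  have eq: "norm (y n) powr p = c powr p * norm (x n) powr p" for n
    using c by (simp add: y powr_mult)
  have s: "summable (\<lambda>n. norm (x n) powr p)" using x by (simp add: ell_def)
  show "y \<in> ell p" using s by (simp add: ell_def eq summable_mult)
  show "ell_norm p y = c * ell_norm p x"
    using s c p by (simp add: ell_norm_def eq suminf_mult powr_mult suminf_nonneg powr_powr)
qed

text \<open>No convergent series converges as slowly as possible: if \<open>r n\<close> is the \<open>n\<close>-th tail of a convergent series with
  positive terms \<open>a' n\<close>, then the terms \<open>a' n / sqrt (r n)\<close> are still summable, because they are at
  most \<open>2 * (sqrt (r n) - sqrt (r (Suc n)))\<close>, which telescopes.  A small multiple of
  \<open>1 / sqrt (r n)\<close> is therefore a divergent weight that changes the sum by little.\<close>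

lemma exists_divergent_weight:
  fixes a :: "nat \<Rightarrow> real"
  assumes a: "\<And>n. 0 \<le> a n" "summable a" and Y: "suminf a < Y"
  obtains b where "\<And>n. 1 \<le> b n" "filterlim b at_top sequentially"
    "summable (\<lambda>n. b n * a n)" "(\<Sum>n. b n * a n) \<le> Y"
proof -
  \<comment> \<open>Adding a geometric series makes all tails positive, so that one can divide by them.\<close>
  define a' where "a' n = a n + (1/2)^n" for n
  have a': "0 < a' n" "a n \<le> a' n" for n
    using a(1)[of n] by (auto simp: a'_def intro: add_nonneg_pos)
  have sa': "summable a'" unfolding a'_def[abs_def]
    by (intro summable_add a summable_geometric) auto
  define r where "r n = suminf a' - sum a' {..<n}" for n
  have rpos: "0 < r n" for n
    using sum_less_suminf[OF sa', of n] a' by (simp add: r_def)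
  have r_Suc: "r n - r (Suc n) = a' n" for n by (simp add: r_def)
  have r0: "r \<longlonglongrightarrow> 0"
    using tendsto_diff[OF tendsto_const[of "suminf a'"] summable_LIMSEQ[OF sa']]
    by (simp add: r_def[abs_def])
  define t where "t n = sqrt (r n)" for n
  have tpos: "0 < t n" for n by (simp add: t_def rpos)
  have t0: "t \<longlonglongrightarrow> 0" using tendsto_real_sqrt[OF r0] by (simp add: t_def[abs_def])
  have tel: "a' n / t n \<le> 2 * (t n - t (Suc n))" for n
  proof -
    have "a' n = (t n)^2 - (t (Suc n))^2"
      using r_Suc[of n] rpos[of n] rpos[of "Suc n"] by (simp add: t_def)
    also have "\<dots> = (t n + t (Suc n)) * (t n - t (Suc n))" by (simp add: power2_eq_square algebra_simps)
    also have "\<dots> \<le> (2 * t n) * (t n - t (Suc n))"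
    proof -
      have "t (Suc n) \<le> t n"
        using r_Suc[of n] a'(1)[of n] by (simp add: t_def)
      then show ?thesis by (intro mult_right_mono) auto
    qed
    finally show ?thesis using tpos[of n] by (simp add: field_simps)
  qed
  have telsum: "(\<lambda>n. 2 * (t n - t (Suc n))) sums (2 * (t 0 - 0))"
    by (intro sums_mult telescope_sums' t0)
  define \<delta> where "\<delta> = (Y - suminf a) / (2 * t 0)"
  have \<delta>: "0 < \<delta>" using Y tpos[of 0] by (simp add: \<delta>_def)
  define b where "b n = 1 + \<delta> / t n" for n
  have b1: "1 \<le> b n" for n using \<delta> tpos[of n] by (simp add: b_def)
  have lim: "filterlim b at_top sequentially"
  proof -
    have "filterlim (\<lambda>n. inverse (t n)) at_top sequentially"
      using t0 tpos by (intro filterlim_inverse_at_top) auto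
    then have "filterlim (\<lambda>n. \<delta> * inverse (t n)) at_top sequentially"
      by (rule filterlim_tendsto_pos_mult_at_top[OF tendsto_const \<delta>])
    then have "filterlim (\<lambda>n. 1 + \<delta> * inverse (t n)) at_top sequentially"
      by (rule filterlim_tendsto_add_at_top[OF tendsto_const])
    then show ?thesis by (simp add: b_def[abs_def] divide_inverse)
  qed
  define u where "u n = a n + \<delta> * (2 * (t n - t (Suc n)))" for n
  have u: "u sums (suminf a + \<delta> * (2 * (t 0 - 0)))"
    unfolding u_def by (intro sums_add sums_mult telsum summable_sums a(2))
  have ba: "b n * a n \<le> u n" for n
  proof -
    have "b n * a n = a n + \<delta> * (a n / t n)" by (simp add: b_def algebra_simps)
    also have "\<delta> * (a n / t n) \<le> \<delta> * (2 * (t n - t (Suc n)))"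
    proof (rule mult_left_mono)
      have "a n / t n \<le> a' n / t n" using a'(2)[of n] tpos[of n] by (intro divide_right_mono) auto
      then show "a n / t n \<le> 2 * (t n - t (Suc n))" using tel[of n] by linarith
    qed (use \<delta> in simp)
    finally show ?thesis by (simp add: u_def)
  qed
  have ba0: "0 \<le> b n * a n" for n using b1[of n] a(1)[of n] by simp
  have sba: "summable (\<lambda>n. b n * a n)"
    by (rule summable_comparison_test'[OF sums_summable[OF u], of 0])
      (use ba ba0 in \<open>auto simp: abs_of_nonneg\<close>)
  have "(\<Sum>n. b n * a n) \<le> suminf u" by (rule suminf_le[OF ba sba sums_summable[OF u]])
  also have "\<dots> = suminf a + \<delta> * (2 * t 0)" using sums_unique[OF u] by simp
  also have "\<dots> = Y" using tpos[of 0] by (simp add: \<delta>_def)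
  finally show ?thesis using that[OF b1 lim sba] by blast
qed

section \<open>Nuclear representations and \<open>p\<close>-convex hulls\<close>

text \<open>The supremum norm controls point values of bounded mappings only, so the remainders of the
  series have to be shown bounded on \<open>U\<close> first.\<close>

lemma right_nuclear_rep_sums:
  assumes f: "f \<in> Hinf U" and rep: "right_nuclear_rep p U f g y" and x: "x \<in> U"
  shows "(\<lambda>n. g n x *\<^sub>C y n) sums f x"
proof -
  have gH: "g n \<in> Hinf U" for n using rep by (simp add: right_nuclear_rep_def ell_weak_Hinf_def)
  define R where "R N = (\<lambda>x. f x - (\<Sum>n<N. g n x *\<^sub>C y n))" for N
  have bnd: "bounded (R N ` U)" for N
  proof -
    obtain B where B: "\<forall>x\<in>U. norm (f x) \<le> B"
      using Hinf_bounded[OF f] by (auto simp: bounded_iff)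
    have "norm (R N x) \<le> B + (\<Sum>n<N. sup_norm U (g n) * norm (y n))" if "x \<in> U" for x
    proof -
      have "norm (R N x) \<le> norm (f x) + norm (\<Sum>n<N. g n x *\<^sub>C y n)"
        unfolding R_def by (rule norm_triangle_ineq4)
      also have "norm (\<Sum>n<N. g n x *\<^sub>C y n) \<le> (\<Sum>n<N. sup_norm U (g n) * norm (y n))"
        by (rule sum_norm_le)
          (auto simp: norm_scaleC intro!: mult_right_mono norm_le_sup_norm Hinf_bounded gH that)
      finally show ?thesis using B that by force
    qed
    then show ?thesis unfolding bounded_iff by blast
  qed
  have "(\<lambda>N. sup_norm U (R N)) \<longlonglongrightarrow> 0" using rep by (simp add: right_nuclear_rep_def R_def)
  then have "(\<lambda>N. R N x) \<longlonglongrightarrow> 0"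
    by (rule Lim_null_comparison[rotated]) (use norm_le_sup_norm[OF bnd x] in auto)
  then have "(\<lambda>N. f x - R N x) \<longlonglongrightarrow> f x - 0" by (intro tendsto_intros)
  then show ?thesis by (simp add: R_def sums_def)
qed

lemma weak_norm_Hinf_nonneg:
  assumes p: "1 \<le> p" and g: "g \<in> ell_weak_Hinf (conj_exponent p) U"
  shows "0 \<le> weak_norm_Hinf (conj_exponent p) U g"
proof (cases "p = 1")
  case True
  then have "bdd_above (range (\<lambda>n. sup_norm U (g n)))" "g 0 \<in> Hinf U"
    using g by (auto simp: ell_weak_Hinf_def conj_exponent_def)
  then show ?thesis using True sup_norm_nonneg[OF Hinf_bounded, of "g 0" U]
    by (auto simp: weak_norm_Hinf_def conj_exponent_def intro: cSUP_upper2)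
next
  case False
  define q where "q = p / (p - 1)"
  have q: "0 < q" "conj_exponent p = ereal q" using p False by (auto simp: q_def conj_exponent_def)
  show ?thesis unfolding q weak_norm_Hinf_def
    using cSUP_upper[OF zero_in_Hinf_dual_ball bdd_above_weak_norm[OF q(1) g[unfolded q(2)]]] q(1)
    by (simp add: ell_norm_def)
qed

lemma ell_norm_nonneg: "0 \<le> ell_norm p x"
  by (simp add: ell_norm_def)

lemma p_conv_memI:
  assumes "a \<in> coeff_ball p" "(\<lambda>n. a n *\<^sub>C z n) sums v"
  shows "v \<in> p_conv p z"
  unfolding p_conv_def using assms sums_unique by blast

lemma scaleC_rescale:
  fixes v :: "'f::complex_banach"
  assumes "c \<noteq> 0"
  shows "(u / complex_of_real c) *\<^sub>C (c *\<^sub>R v) = u *\<^sub>C v"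
  using assms by (simp add: scaleC_scaleC flip: scaleC_of_real)

text \<open>Strict upper bounds \<open>W\<close> and \<open>Y\<close> serve two purposes: \<open>W\<close> is positive and one may divide by
  it even if the weak norm vanishes, and the gap between \<open>Y\<close> and the norm of \<open>y\<close> leaves room for
  the divergent weights in the case \<open>p = 1\<close>.\<close>

lemma nuclear_range_subset_p_conv:
  assumes p: "1 \<le> p" and f: "f \<in> Hinf U" and rep: "right_nuclear_rep p U f g y"
    and W: "weak_norm_Hinf (conj_exponent p) U g < W" and Y: "ell_norm p y < Y"
  shows "\<exists>z\<in>ell p. f ` U \<subseteq> p_conv p z \<and> ell_norm p z \<le> W * Y"
proof -
  have g: "g \<in> ell_weak_Hinf (conj_exponent p) U" and y: "y \<in> ell p"
    using rep by (auto simp: right_nuclear_rep_def)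
  have gH: "g n \<in> Hinf U" for n using g by (simp add: ell_weak_Hinf_def)
  have W0: "0 < W" using weak_norm_Hinf_nonneg[OF p g] W by linarith
  note sums = right_nuclear_rep_sums[OF f rep]
  show ?thesis
  proof (cases "p = 1")
    case False
    define q where "q = p / (p - 1)"
    have q: "0 < q" "conj_exponent p = ereal q" using p False by (auto simp: q_def conj_exponent_def)
    define z where "z n = W *\<^sub>R y n" for n
    have z: "z \<in> ell p" "ell_norm p z = W * ell_norm p y"
      using ell_scale[of p y W z] p y W0 by (auto simp: z_def)
    have "f x \<in> p_conv p z" if x: "x \<in> U" for x
    proof (rule p_conv_memI)
      define a where "a n = g n x / complex_of_real W" for n
      have ball: "(\<lambda>g. g x) \<in> Hinf_dual_ball U" by (rule evaluation_in_Hinf_dual_ball[OF x])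
      have gx: "(\<lambda>n. g n x) \<in> ell q"
        using g ball by (auto simp: q(2) ell_weak_Hinf_def Hinf_dual_ball_def)
      have "ell_norm q (\<lambda>n. g n x) \<le> weak_norm_Hinf (conj_exponent p) U g"
        using cSUP_upper[OF ball bdd_above_weak_norm[OF q(1) g[unfolded q(2)]]]
        by (simp add: weak_norm_Hinf_def q(2))
      then have le: "(1/W) * ell_norm q (\<lambda>n. g n x) \<le> 1" using W W0 by simp
      have "a \<in> ell q" "ell_norm q a = (1/W) * ell_norm q (\<lambda>n. g n x)"
        using ell_scale[OF q(1) gx, of "1/W" a] W0 by (simp_all add: a_def norm_divide)
      then show "a \<in> coeff_ball p" using le False by (simp add: coeff_ball_def q(2))
      show "(\<lambda>n. a n *\<^sub>C z n) sums f x"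
        using sums[OF x] W0 by (simp add: a_def z_def scaleC_rescale)
    qed
    then show ?thesis using z Y W0 by (intro bexI[of _ z]) auto
  next
    case True
    have ynn: "(\<Sum>n. norm (y n)) = ell_norm p y" "summable (\<lambda>n. norm (y n))"
      using y True by (simp_all add: ell_norm_def ell_def suminf_nonneg)
    obtain b where b: "\<And>n. 1 \<le> b n" "filterlim b at_top sequentially"
      "summable (\<lambda>n. b n * norm (y n))" "(\<Sum>n. b n * norm (y n)) \<le> Y"
      using exists_divergent_weight[of "\<lambda>n. norm (y n)" Y] ynn Y by auto
    have b0: "0 < b n" for n using b(1)[of n] by linarith
    define z where "z n = (W * b n) *\<^sub>R y n" for n
    have nz: "norm (z n) = W * (b n * norm (y n))" for n
      using W0 b0[of n] by (simp add: z_def abs_mult)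
    have z: "z \<in> ell p" using b(3) W0 True by (simp add: ell_def nz summable_mult)
    have "ell_norm p z = (\<Sum>n. W * (b n * norm (y n)))"
      using True W0 b0 b(3)
      by (simp add: ell_norm_def nz suminf_nonneg summable_mult less_imp_le)
    also have "\<dots> = W * (\<Sum>n. b n * norm (y n))" using b(3) by (rule suminf_mult)
    also have "\<dots> \<le> W * Y" using b(4) W0 by simp
    finally have zn: "ell_norm p z \<le> W * Y" .
    have "f x \<in> p_conv p z" if x: "x \<in> U" for x
    proof (rule p_conv_memI)
      define a where "a n = g n x / complex_of_real (W * b n)" for n
      have gx: "cmod (g n x) \<le> W" for n
      proof -
        have "cmod (g n x) \<le> sup_norm U (g n)" by (rule norm_le_sup_norm[OF Hinf_bounded[OF gH] x])
        also have "\<dots> \<le> weak_norm_Hinf (conj_exponent p) U g"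
          using g True by (auto simp: ell_weak_Hinf_def weak_norm_Hinf_def conj_exponent_def
              intro: cSUP_upper)
        finally show ?thesis using W by simp
      qed
      have an: "cmod (a n) \<le> inverse (b n)" for n
        using gx[of n] W0 b0[of n] by (simp add: a_def norm_divide norm_mult field_simps)
      have "(\<lambda>n. inverse (b n)) \<longlonglongrightarrow> 0"
        by (rule tendsto_inverse_0_at_top[OF b(2)])
      then have "a \<longlonglongrightarrow> 0"
        by (rule Lim_null_comparison[rotated]) (use an in auto)
      moreover have "cmod (a n) \<le> 1" for n
        using an[of n] b(1)[of n] by (meson inverse_le_1_iff order_trans)
      ultimately show "a \<in> coeff_ball p" using True by (simp add: coeff_ball_def)
      have "a n *\<^sub>C z n = g n x *\<^sub>C y n" for n
        unfolding a_def z_def using W0 b0[of n] by (intro scaleC_rescale) auto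
      then show "(\<lambda>n. a n *\<^sub>C z n) sums f x" using sums[OF x] by simp
    qed
    then show ?thesis using z zn by blast
  qed
qed

lemma le_mult_of_le_mult_above:
  fixes k :: real
  assumes "\<And>w' y'. w < w' \<Longrightarrow> y < y' \<Longrightarrow> k \<le> w' * y'"
  shows "k \<le> w * y"
proof (rule LIMSEQ_le_const)
  have "(\<lambda>n. (w + inverse (real (Suc n))) * (y + inverse (real (Suc n)))) \<longlonglongrightarrow> (w + 0) * (y + 0)"
    by (intro tendsto_intros LIMSEQ_inverse_real_of_nat)
  then show "(\<lambda>n. (w + inverse (real (Suc n))) * (y + inverse (real (Suc n)))) \<longlonglongrightarrow> w * y" by simp
  show "\<exists>N. \<forall>n\<ge>N. k \<le> (w + inverse (real (Suc n))) * (y + inverse (real (Suc n)))"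
    using assms by auto
qed

theorem corollary1p17:
  fixes U :: "'e::complex_banach set"
    and f :: "'e \<Rightarrow> 'f::complex_banach"
    and p :: real
  assumes "open U"
    and "1 \<le> p"
    and "f \<in> Hinf_N p U"
  shows "f \<in> Hinf_K p U \<and> k_p p U f \<le> nu_p p U f"
proof
  have f: "f \<in> Hinf U" and ex: "\<exists>g y. right_nuclear_rep p U f g y"
    using assms(3) by (auto simp: Hinf_N_def)
  note cover = nuclear_range_subset_p_conv[OF assms(2) f]
  show "f \<in> Hinf_K p U"
  proof -
    obtain g y where "right_nuclear_rep p U f g y" using ex by blast
    from cover[OF this less_add_one less_add_one] show ?thesis
      using f by (auto simp: Hinf_K_def Hinf_def relatively_p_compact_def)
  qed
  show "k_p p U f \<le> nu_p p U f"
    unfolding nu_p_def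
  proof (rule cInf_greatest)
    fix t assume "t \<in> {weak_norm_Hinf (conj_exponent p) U g * ell_norm p y | g y.
        right_nuclear_rep p U f g y}"
    then obtain g y where rep: "right_nuclear_rep p U f g y"
      and t: "t = weak_norm_Hinf (conj_exponent p) U g * ell_norm p y" by blast
    show "k_p p U f \<le> t" unfolding t
    proof (rule le_mult_of_le_mult_above)
      fix W Y assume "weak_norm_Hinf (conj_exponent p) U g < W" "ell_norm p y < Y"
      from cover[OF rep this] obtain z where z: "z \<in> ell p" "f ` U \<subseteq> p_conv p z"
        "ell_norm p z \<le> W * Y" by blast
      have "k_p p U f \<le> ell_norm p z"
        unfolding k_p_def m_p_def
        by (rule cInf_lower) (use z ell_norm_nonneg in \<open>auto intro!: bdd_belowI[of _ 0]\<close>)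
      with z(3) show "k_p p U f \<le> W * Y" by simp
    qed
  qed (use ex in auto)
qed

end
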